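(* Let $P$ be a stratified $\Sigma(\Pi)$-aggregate program. For any three-valued $\Sigma$-structure $\hat{\mathcal{D}}$ approximating $\mathcal{D}$, the $\hat{\mathcal{D}}$-well-founded model of $P$ is two-valued and is equal to the standard model of $P$ extending $\mathcal{D}$ and to the unique $\hat{\mathcal{D}}$-stable model of $P$.
   Context: Setting: a fixed aggregate signature $\Sigma$ (sorts, function, predicate and aggregate symbols, where an aggregate symbol denotes a relation between sets and domain elements) with a fixed two-valued $\Sigma$-structure $\mathcal{D}$, and a set $\Pi$ of defined predicate symbols. An aggregate program $P$ is a set of rules $A \gets \varphi$ with $A$ an atom of a defined predicate and $\varphi$ a first-order formula that may contain aggregate atoms $\mathcal{R}(\{\bar x \mid \psi\}, t)$. Interpretations are subsets $I$ of the set of ground defined atoms over the domain of $\mathcal{D}$; $\mathcal{D}(I)$ is the extension of $\mathcal{D}$ making exactly the atoms of $I$ true. The two-valued immediate consequence operator is $T_{P,\mathcal{D}}(I)=\{A \mid A\gets\varphi \text{ a ground instance of a rule of } P,\ \mathcal{D}(I)\models\varphi\}$. $P$ is stratified if each defined predicate $p$ has a level $|p|>0$ such that, for every rule with head predicate $p$, if $q$ occurs positively in its body then $|q|\le|p|$, and if $q$ occurs negatively in the body or inside an aggregate atom then $|q|<|p|$. With $P_i$ the rules whose head has level $i$, the standard model is $\bigcup_i I_i$ where $\mathcal{D}_0=\mathcal{D}$, $I_i=\mathrm{lfp}(T_{P_i,\mathcal{D}_{i-1}})$, $\mathcal{D}_i=\mathcal{D}(\bigcup_{j\le i} I_j)$.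 A three-valued aggregate relation is a map from pairs (three-valued set $(S_1,S_2)$ with $S_1\subseteq S_2$, domain element $d$) to the truth values $\{f,u,t\}$ that is monotone in the precision order in the set argument and two-valued on exact sets $(S,S)$; it approximates an aggregate relation $\mathcal{R}$ if it agrees with $\mathcal{R}$ on exact sets. A three-valued $\Sigma$-structure $\hat{\mathcal{D}}$ approximates $\mathcal{D}$ if it has the same domains and functions, interprets predicates of $\Sigma$ as in $\mathcal{D}$ (two-valued), and interprets each aggregate symbol by a three-valued aggregate relation approximating its $\mathcal{D}$-interpretation. Formulas are evaluated in $\hat{\mathcal{D}}$ extended with a three-valued interpretation of $\Pi$ using Kleene's strong three-valued logic. The three-valued immediate consequence operator $\Phi_{P,\hat{\mathcal{D}}}$ maps a three-valued interpretation $\hat I$ to the one assigning to each ground defined atom $A$ the disjunction (maximum in truth order) of the three-valued truth values of the bodies of all ground rule instances with head $A$; it is an approximating operator of $T_{P,\mathcal{D}}$. The $\hat{\mathcal{D}}$-well-founded model and $\hat{\mathcal{D}}$-stable models of $P$ are the well-founded fixpoint and the exact stable fixpoints of $\Phi_{P,\hat{\mathcal{D}}}$ in approximation fixpoint theory. *)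

theory Defs
  imports Main
begin

section \<open>Kleene truth values\<close>

datatype tv = TFalse | TUndef | TTrue

text \<open>The class order is the truth order \<open>f < u < t\<close>; on \<^typ>\<open>tv\<close>, Kleene's connectives are
  \<open>inf\<close>, \<open>sup\<close> and \<open>-\<close>, and his quantifiers are the infinitary meet and join.\<close>

instantiation tv :: complete_linorder
begin

definition less_eq_tv :: "tv \<Rightarrow> tv \<Rightarrow> bool" where
  "x \<le> y \<longleftrightarrow> x = TFalse \<or> y = TTrue \<or> x = y"

definition less_tv :: "tv \<Rightarrow> tv \<Rightarrow> bool" where
  "x < y \<longleftrightarrow> x \<le> y \<and> x \<noteq> (y::tv)"

definition inf_tv :: "tv \<Rightarrow> tv \<Rightarrow> tv" where
  "inf x (y::tv) = (if x \<le> y then x else y)"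

definition sup_tv :: "tv \<Rightarrow> tv \<Rightarrow> tv" where
  "sup x (y::tv) = (if x \<le> y then y else x)"

definition bot_tv :: tv where "bot = TFalse"

definition top_tv :: tv where "top = TTrue"

definition Inf_tv :: "tv set \<Rightarrow> tv" where
  "Inf X = (if TFalse \<in> X then TFalse else if TUndef \<in> X then TUndef else TTrue)"

definition Sup_tv :: "tv set \<Rightarrow> tv" where
  "Sup X = (if TTrue \<in> X then TTrue else if TUndef \<in> X then TUndef else TFalse)"

instance
proof
  fix x y z :: tv and X :: "tv set"
  show "(x < y) = (x \<le> y \<and> \<not> y \<le> x)" "x \<le> x" "x \<le> y \<or> y \<le> x"
    by (cases x; cases y; simp add: less_tv_def less_eq_tv_def)+
  show "x \<le> y \<Longrightarrow> y \<le> z \<Longrightarrow> x \<le> z" "x \<le> y \<Longrightarrow> y \<le> x \<Longrightarrow> x = y"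
    by (auto simp: less_eq_tv_def)
  show "inf x y \<le> x" "inf x y \<le> y" "x \<le> y \<Longrightarrow> x \<le> z \<Longrightarrow> x \<le> inf y z"
    "x \<le> sup x y" "y \<le> sup x y" "y \<le> x \<Longrightarrow> z \<le> x \<Longrightarrow> sup y z \<le> x"
    by (cases x; cases y; cases z; simp add: inf_tv_def sup_tv_def less_eq_tv_def)+
  show "x \<in> X \<Longrightarrow> Inf X \<le> x" "x \<in> X \<Longrightarrow> x \<le> Sup X"
    by (cases x; auto simp: Inf_tv_def Sup_tv_def less_eq_tv_def)+
  show "z \<le> Inf X" if "\<And>x. x \<in> X \<Longrightarrow> z \<le> x"
    using that[of TFalse] that[of TUndef] by (auto simp: Inf_tv_def less_eq_tv_def)
  show "Sup X \<le> z" if "\<And>x. x \<in> X \<Longrightarrow> x \<le> z"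
    using that[of TTrue] that[of TUndef] by (auto simp: Sup_tv_def less_eq_tv_def)
  show "Inf {} = (top::tv)" "Sup {} = (bot::tv)"
    by (simp_all add: Inf_tv_def Sup_tv_def top_tv_def bot_tv_def)
qed

end

instantiation tv :: uminus
begin

fun uminus_tv :: "tv \<Rightarrow> tv" where
  "- TFalse = TTrue"
| "- TUndef = TUndef"
| "- TTrue = TFalse"

instance ..

end

definition tv_prec :: "tv \<Rightarrow> tv \<Rightarrow> bool" where
  "tv_prec x y \<longleftrightarrow> x = TUndef \<or> x = y"

definition tv_of_bool :: "bool \<Rightarrow> tv" where
  "tv_of_bool b = (if b then TTrue else TFalse)"

text \<open>A consistent pair \<open>(X\<^sub>1, X\<^sub>2)\<close> of sets, \<open>X\<^sub>1 \<subseteq> X\<^sub>2\<close>, is the three-valued set whose members are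
  certain (those of \<open>X\<^sub>1\<close>) or possible (those of \<open>X\<^sub>2\<close>). The next two functions translate between
  such pairs and characteristic functions on a universe \<open>U\<close>.\<close>

definition tv_mem :: "'x \<Rightarrow> 'x set \<times> 'x set \<Rightarrow> tv" where
  "tv_mem x X = (if x \<in> fst X then TTrue else if x \<in> snd X then TUndef else TFalse)"

definition tv_Collect :: "'x set \<Rightarrow> ('x \<Rightarrow> tv) \<Rightarrow> 'x set \<times> 'x set" where
  "tv_Collect U f = ({x \<in> U. f x = TTrue}, {x \<in> U. f x \<noteq> TFalse})"


section \<open>Approximation fixpoint theory\<close>

definition consistent_pairs :: "'l::order set \<Rightarrow> ('l \<times> 'l) set" where
  "consistent_pairs L = {(x, y). x \<in> L \<and> y \<in> L \<and> x \<le> y}"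

definition prec_le :: "'l::order \<times> 'l \<Rightarrow> 'l \<times> 'l \<Rightarrow> bool" where
  "prec_le p q \<longleftrightarrow> fst p \<le> fst q \<and> snd q \<le> snd p"

definition is_least_fixpoint :: "'l::order set \<Rightarrow> ('l \<Rightarrow> 'l) \<Rightarrow> 'l \<Rightarrow> bool" where
  "is_least_fixpoint X f x \<longleftrightarrow> x \<in> X \<and> f x = x \<and> (\<forall>y\<in>X. f y = y \<longrightarrow> x \<le> y)"

text \<open>In the following, \<open>L\<close> is the carrier of a complete lattice and \<open>A\<close> an approximating operator
  on the consistent pairs over \<open>L\<close>.\<close>

definition reliable :: "'l::order set \<Rightarrow> ('l \<times> 'l \<Rightarrow> 'l \<times> 'l) \<Rightarrow> 'l \<times> 'l \<Rightarrow> bool" where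
  "reliable L A p \<longleftrightarrow> p \<in> consistent_pairs L \<and> prec_le p (A p)"

text \<open>\<open>stable_revision L A (a, b) (a', b')\<close> is the graph of the stable revision operator:
  \<open>a'\<close> is the least fixpoint of \<open>A\<^sup>1(\<cdot>, b)\<close> on \<open>[\<bottom>, b]\<close> and \<open>b'\<close> the least fixpoint of
  \<open>A\<^sup>2(a, \<cdot>)\<close> on \<open>[a, \<top>]\<close>. It is a relation, so that no value is made up where a least fixpoint
  fails to exist.\<close>

definition stable_revision ::
  "'l::order set \<Rightarrow> ('l \<times> 'l \<Rightarrow> 'l \<times> 'l) \<Rightarrow> 'l \<times> 'l \<Rightarrow> 'l \<times> 'l \<Rightarrow> bool" where
  "stable_revision L A p p' \<longleftrightarrow>
     is_least_fixpoint {x \<in> L. x \<le> snd p} (\<lambda>x. fst (A (x, snd p))) (fst p') \<and>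
     is_least_fixpoint {y \<in> L. fst p \<le> y} (\<lambda>y. snd (A (fst p, y))) (snd p')"

definition prudent :: "'l::order set \<Rightarrow> ('l \<times> 'l \<Rightarrow> 'l \<times> 'l) \<Rightarrow> 'l \<times> 'l \<Rightarrow> bool" where
  "prudent L A p \<longleftrightarrow>
     reliable L A p \<and> (\<exists>p'. stable_revision L A p p' \<and> fst p \<le> fst p')"

definition stable_fixpoint :: "'l::order set \<Rightarrow> ('l \<times> 'l \<Rightarrow> 'l \<times> 'l) \<Rightarrow> 'l \<times> 'l \<Rightarrow> bool" where
  "stable_fixpoint L A p \<longleftrightarrow> reliable L A p \<and> stable_revision L A p p"

text \<open>The well-founded fixpoint is the least precise fixpoint of the stable revision operator on
  the chain-complete poset of reliable prudent pairs.\<close>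

definition well_founded_fixpoint ::
  "'l::order set \<Rightarrow> ('l \<times> 'l \<Rightarrow> 'l \<times> 'l) \<Rightarrow> 'l \<times> 'l \<Rightarrow> bool" where
  "well_founded_fixpoint L A p \<longleftrightarrow>
     prudent L A p \<and> stable_revision L A p p \<and>
     (\<forall>q. prudent L A q \<and> stable_revision L A q q \<longrightarrow> prec_le p q)"


section \<open>Syntax\<close>

text \<open>The symbols are the elements of the types \<open>'s\<close> (sorts), \<open>'f\<close>, \<open>'p\<close> and \<open>'a\<close>; a signature
  assigns them their sorts. The type \<open>'p\<close> holds the predicate symbols of the extended signature
  \<open>\<Sigma>(\<Pi>)\<close>: those in the set \<open>\<Pi>\<close> are defined, the others belong to \<open>\<Sigma>\<close>.
  An aggregate symbol with set sorts \<open>s\<^sub>1, \<dots>, s\<^sub>n\<close> and element sort \<open>w\<close> relates subsets of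
  \<open>D\<^bsub>s\<^sub>1\<^esub> \<times> \<dots> \<times> D\<^bsub>s\<^sub>n\<^esub>\<close> to elements of \<open>D\<^bsub>w\<^esub>\<close>.\<close>

record ('s, 'f, 'p, 'a) signature =
  fun_args :: "'f \<Rightarrow> 's list"
  fun_res :: "'f \<Rightarrow> 's"
  pred_args :: "'p \<Rightarrow> 's list"
  agg_set :: "'a \<Rightarrow> 's list"
  agg_elem :: "'a \<Rightarrow> 's"

text \<open>A variable is a name together with its sort.\<close>

type_synonym 's var = "nat \<times> 's"

datatype ('s, 'f) trm = Var "'s var" | Fun 'f "('s, 'f) trm list"

text \<open>\<open>Agg R xs \<psi> t\<close> is the aggregate atom \<open>R({xs | \<psi>}, t)\<close>, which binds \<open>xs\<close> in \<open>\<psi>\<close>.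
  The set function \<open>fm_preds\<close> yields all predicate symbols of a formula.\<close>

datatype (dead 's, dead 'f, fm_preds: 'p, dead 'a) fm =
    Tru
  | Fls
  | Eq "('s, 'f) trm" "('s, 'f) trm"
  | Atom 'p "('s, 'f) trm list"
  | Neg "('s, 'f, 'p, 'a) fm"
  | Conj "('s, 'f, 'p, 'a) fm" "('s, 'f, 'p, 'a) fm"
  | Disj "('s, 'f, 'p, 'a) fm" "('s, 'f, 'p, 'a) fm"
  | Forall "'s var" "('s, 'f, 'p, 'a) fm"
  | Exists "'s var" "('s, 'f, 'p, 'a) fm"
  | Agg 'a "'s var list" "('s, 'f, 'p, 'a) fm" "('s, 'f) trm"

datatype ('s, 'f, 'p, 'a) rule =
  Rule (head_pred: 'p) (head_args: "('s, 'f) trm list") (body: "('s, 'f, 'p, 'a) fm")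

primrec sort_of :: "('s, 'f, 'p, 'a) signature \<Rightarrow> ('s, 'f) trm \<Rightarrow> 's" where
  "sort_of \<Sigma> (Var x) = snd x"
| "sort_of \<Sigma> (Fun f ts) = fun_res \<Sigma> f"

fun wf_trm :: "('s, 'f, 'p, 'a) signature \<Rightarrow> ('s, 'f) trm \<Rightarrow> bool" where
  "wf_trm \<Sigma> (Var x) \<longleftrightarrow> True"
| "wf_trm \<Sigma> (Fun f ts) \<longleftrightarrow> (\<forall>t\<in>set ts. wf_trm \<Sigma> t) \<and> map (sort_of \<Sigma>) ts = fun_args \<Sigma> f"

definition wf_atom :: "('s, 'f, 'p, 'a) signature \<Rightarrow> 'p \<Rightarrow> ('s, 'f) trm list \<Rightarrow> bool" where
  "wf_atom \<Sigma> p ts \<longleftrightarrow> (\<forall>t\<in>set ts. wf_trm \<Sigma> t) \<and> map (sort_of \<Sigma>) ts = pred_args \<Sigma> p"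

primrec wf_fm :: "('s, 'f, 'p, 'a) signature \<Rightarrow> ('s, 'f, 'p, 'a) fm \<Rightarrow> bool" where
  "wf_fm \<Sigma> Tru \<longleftrightarrow> True"
| "wf_fm \<Sigma> Fls \<longleftrightarrow> True"
| "wf_fm \<Sigma> (Eq t u) \<longleftrightarrow> wf_trm \<Sigma> t \<and> wf_trm \<Sigma> u \<and> sort_of \<Sigma> t = sort_of \<Sigma> u"
| "wf_fm \<Sigma> (Atom p ts) \<longleftrightarrow> wf_atom \<Sigma> p ts"
| "wf_fm \<Sigma> (Neg \<phi>) \<longleftrightarrow> wf_fm \<Sigma> \<phi>"
| "wf_fm \<Sigma> (Conj \<phi> \<psi>) \<longleftrightarrow> wf_fm \<Sigma> \<phi> \<and> wf_fm \<Sigma> \<psi>"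
| "wf_fm \<Sigma> (Disj \<phi> \<psi>) \<longleftrightarrow> wf_fm \<Sigma> \<phi> \<and> wf_fm \<Sigma> \<psi>"
| "wf_fm \<Sigma> (Forall x \<phi>) \<longleftrightarrow> wf_fm \<Sigma> \<phi>"
| "wf_fm \<Sigma> (Exists x \<phi>) \<longleftrightarrow> wf_fm \<Sigma> \<phi>"
| "wf_fm \<Sigma> (Agg R xs \<psi> t) \<longleftrightarrow>
     distinct xs \<and> map snd xs = agg_set \<Sigma> R \<and> wf_fm \<Sigma> \<psi> \<and>
     wf_trm \<Sigma> t \<and> sort_of \<Sigma> t = agg_elem \<Sigma> R"

definition aggregate_program ::
  "('s, 'f, 'p, 'a) signature \<Rightarrow> 'p set \<Rightarrow> ('s, 'f, 'p, 'a) rule set \<Rightarrow> bool" where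
  "aggregate_program \<Sigma> \<Pi> P \<longleftrightarrow>
     (\<forall>r\<in>P. head_pred r \<in> \<Pi> \<and> wf_atom \<Sigma> (head_pred r) (head_args r) \<and> wf_fm \<Sigma> (body r))"

text \<open>\<open>occurs True \<phi>\<close> and \<open>occurs False \<phi>\<close> are the predicates with a positive respectively a
  negative occurrence in \<open>\<phi>\<close> outside aggregate atoms.\<close>

primrec occurs :: "bool \<Rightarrow> ('s, 'f, 'p, 'a) fm \<Rightarrow> 'p set" where
  "occurs b Tru = {}"
| "occurs b Fls = {}"
| "occurs b (Eq t u) = {}"
| "occurs b (Atom p ts) = (if b then {p} else {})"
| "occurs b (Neg \<phi>) = occurs (\<not> b) \<phi>"
| "occurs b (Conj \<phi> \<psi>) = occurs b \<phi> \<union> occurs b \<psi>"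
| "occurs b (Disj \<phi> \<psi>) = occurs b \<phi> \<union> occurs b \<psi>"
| "occurs b (Forall x \<phi>) = occurs b \<phi>"
| "occurs b (Exists x \<phi>) = occurs b \<phi>"
| "occurs b (Agg R xs \<psi> t) = {}"

primrec occurs_agg :: "('s, 'f, 'p, 'a) fm \<Rightarrow> 'p set" where
  "occurs_agg Tru = {}"
| "occurs_agg Fls = {}"
| "occurs_agg (Eq t u) = {}"
| "occurs_agg (Atom p ts) = {}"
| "occurs_agg (Neg \<phi>) = occurs_agg \<phi>"
| "occurs_agg (Conj \<phi> \<psi>) = occurs_agg \<phi> \<union> occurs_agg \<psi>"
| "occurs_agg (Disj \<phi> \<psi>) = occurs_agg \<phi> \<union> occurs_agg \<psi>"
| "occurs_agg (Forall x \<phi>) = occurs_agg \<phi>"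
| "occurs_agg (Exists x \<phi>) = occurs_agg \<phi>"
| "occurs_agg (Agg R xs \<psi> t) = fm_preds \<psi>"

definition stratification ::
  "'p set \<Rightarrow> ('s, 'f, 'p, 'a) rule set \<Rightarrow> ('p \<Rightarrow> nat) \<Rightarrow> bool" where
  "stratification \<Pi> P lev \<longleftrightarrow>
     (\<forall>p\<in>\<Pi>. lev p > 0) \<and>
     (\<forall>r\<in>P. \<forall>q\<in>\<Pi>.
        (q \<in> occurs True (body r) \<longrightarrow> lev q \<le> lev (head_pred r)) \<and>
        (q \<in> occurs False (body r) \<union> occurs_agg (body r) \<longrightarrow> lev q < lev (head_pred r)))"


section \<open>Structures\<close>

record ('s, 'f, 'd) algebra =
  dom_of :: "'s \<Rightarrow> 'd set"
  fun_int :: "'f \<Rightarrow> 'd list \<Rightarrow> 'd"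

record ('s, 'f, 'p, 'a, 'd) struct = "('s, 'f, 'd) algebra" +
  pred_int :: "'p \<Rightarrow> 'd list \<Rightarrow> bool"
  agg_int :: "'a \<Rightarrow> 'd list set \<Rightarrow> 'd \<Rightarrow> bool"

record ('s, 'f, 'p, 'a, 'd) struct3 = "('s, 'f, 'd) algebra" +
  pred_int3 :: "'p \<Rightarrow> 'd list \<Rightarrow> tv"
  agg_int3 :: "'a \<Rightarrow> 'd list set \<times> 'd list set \<Rightarrow> 'd \<Rightarrow> tv"

definition tuples :: "('s, 'f, 'd, 'z) algebra_scheme \<Rightarrow> 's list \<Rightarrow> 'd list set" where
  "tuples D ss = {ds. list_all2 (\<lambda>d s. d \<in> dom_of D s) ds ss}"

text \<open>The values of \<open>fun_int\<close>, \<open>pred_int\<close> and \<open>agg_int\<close> matter only on arguments from the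
  appropriate domains.\<close>

definition is_algebra ::
  "('s, 'f, 'p, 'a) signature \<Rightarrow> ('s, 'f, 'd, 'z) algebra_scheme \<Rightarrow> bool" where
  "is_algebra \<Sigma> D \<longleftrightarrow>
     (\<forall>s. dom_of D s \<noteq> {}) \<and>
     (\<forall>f. \<forall>ds\<in>tuples D (fun_args \<Sigma> f). fun_int D f ds \<in> dom_of D (fun_res \<Sigma> f))"

definition three_valued_aggregate ::
  "'x set \<Rightarrow> 'd set \<Rightarrow> ('x set \<times> 'x set \<Rightarrow> 'd \<Rightarrow> tv) \<Rightarrow> bool" where
  "three_valued_aggregate U E R \<longleftrightarrow>
     (\<forall>X \<in> consistent_pairs (Pow U). \<forall>Y \<in> consistent_pairs (Pow U). \<forall>d\<in>E.
        prec_le X Y \<longrightarrow> tv_prec (R X d) (R Y d)) \<and>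
     (\<forall>S \<in> Pow U. \<forall>d\<in>E. R (S, S) d \<noteq> TUndef)"

definition approximates ::
  "('s, 'f, 'p, 'a) signature \<Rightarrow> 'p set \<Rightarrow>
   ('s, 'f, 'p, 'a, 'd) struct3 \<Rightarrow> ('s, 'f, 'p, 'a, 'd) struct \<Rightarrow> bool" where
  "approximates \<Sigma> \<Pi> D3 D \<longleftrightarrow>
     dom_of D3 = dom_of D \<and>
     (\<forall>f. \<forall>ds\<in>tuples D (fun_args \<Sigma> f). fun_int D3 f ds = fun_int D f ds) \<and>
     (\<forall>p. p \<notin> \<Pi> \<longrightarrow>
        (\<forall>ds\<in>tuples D (pred_args \<Sigma> p). pred_int3 D3 p ds = tv_of_bool (pred_int D p ds))) \<and>
     (\<forall>R. three_valued_aggregate (tuples D (agg_set \<Sigma> R)) (dom_of D (agg_elem \<Sigma> R)) (agg_int3 D3 R) \<and>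
        (\<forall>S \<in> Pow (tuples D (agg_set \<Sigma> R)). \<forall>d \<in> dom_of D (agg_elem \<Sigma> R).
           agg_int3 D3 R (S, S) d = tv_of_bool (agg_int D R S d)))"


section \<open>Evaluation\<close>

definition assignments :: "('s, 'f, 'd, 'z) algebra_scheme \<Rightarrow> ('s var \<Rightarrow> 'd) set" where
  "assignments D = {v. \<forall>x. v x \<in> dom_of D (snd x)}"

definition upds :: "('x \<Rightarrow> 'd) \<Rightarrow> 'x list \<Rightarrow> 'd list \<Rightarrow> 'x \<Rightarrow> 'd" where
  "upds v xs ds = (\<lambda>y. case map_of (zip xs ds) y of None \<Rightarrow> v y | Some d \<Rightarrow> d)"

primrec trm_val :: "('s, 'f, 'd, 'z) algebra_scheme \<Rightarrow> ('s var \<Rightarrow> 'd) \<Rightarrow> ('s, 'f) trm \<Rightarrow> 'd" where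
  "trm_val D v (Var x) = v x"
| "trm_val D v (Fun f ts) = fun_int D f (map (trm_val D v) ts)"

primrec sat ::
  "('s, 'f, 'p, 'a, 'd) struct \<Rightarrow> ('s var \<Rightarrow> 'd) \<Rightarrow> ('s, 'f, 'p, 'a) fm \<Rightarrow> bool" where
  "sat D v Tru \<longleftrightarrow> True"
| "sat D v Fls \<longleftrightarrow> False"
| "sat D v (Eq t u) \<longleftrightarrow> trm_val D v t = trm_val D v u"
| "sat D v (Atom p ts) \<longleftrightarrow> pred_int D p (map (trm_val D v) ts)"
| "sat D v (Neg \<phi>) \<longleftrightarrow> \<not> sat D v \<phi>"
| "sat D v (Conj \<phi> \<psi>) \<longleftrightarrow> sat D v \<phi> \<and> sat D v \<psi>"
| "sat D v (Disj \<phi> \<psi>) \<longleftrightarrow> sat D v \<phi> \<or> sat D v \<psi>"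
| "sat D v (Forall x \<phi>) \<longleftrightarrow> (\<forall>d \<in> dom_of D (snd x). sat D (v(x := d)) \<phi>)"
| "sat D v (Exists x \<phi>) \<longleftrightarrow> (\<exists>d \<in> dom_of D (snd x). sat D (v(x := d)) \<phi>)"
| "sat D v (Agg R xs \<psi> t) \<longleftrightarrow>
     agg_int D R {ds \<in> tuples D (map snd xs). sat D (upds v xs ds) \<psi>} (trm_val D v t)"

primrec val3 ::
  "('s, 'f, 'p, 'a, 'd) struct3 \<Rightarrow> ('s var \<Rightarrow> 'd) \<Rightarrow> ('s, 'f, 'p, 'a) fm \<Rightarrow> tv" where
  "val3 D v Tru = TTrue"
| "val3 D v Fls = TFalse"
| "val3 D v (Eq t u) = tv_of_bool (trm_val D v t = trm_val D v u)"
| "val3 D v (Atom p ts) = pred_int3 D p (map (trm_val D v) ts)"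
| "val3 D v (Neg \<phi>) = - val3 D v \<phi>"
| "val3 D v (Conj \<phi> \<psi>) = inf (val3 D v \<phi>) (val3 D v \<psi>)"
| "val3 D v (Disj \<phi> \<psi>) = sup (val3 D v \<phi>) (val3 D v \<psi>)"
| "val3 D v (Forall x \<phi>) = (INF d \<in> dom_of D (snd x). val3 D (v(x := d)) \<phi>)"
| "val3 D v (Exists x \<phi>) = (SUP d \<in> dom_of D (snd x). val3 D (v(x := d)) \<phi>)"
| "val3 D v (Agg R xs \<psi> t) =
     agg_int3 D R (tv_Collect (tuples D (map snd xs)) (\<lambda>ds. val3 D (upds v xs ds) \<psi>))
       (trm_val D v t)"


section \<open>Semantics of aggregate programs\<close>

definition ground_atoms ::
  "('s, 'f, 'p, 'a) signature \<Rightarrow> 'p set \<Rightarrow> ('s, 'f, 'd, 'z) algebra_scheme \<Rightarrow>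
   ('p \<times> 'd list) set" where
  "ground_atoms \<Sigma> \<Pi> D = {(p, ds). p \<in> \<Pi> \<and> ds \<in> tuples D (pred_args \<Sigma> p)}"

definition extend ::
  "('s, 'f, 'p, 'a, 'd) struct \<Rightarrow> 'p set \<Rightarrow> ('p \<times> 'd list) set \<Rightarrow> ('s, 'f, 'p, 'a, 'd) struct" where
  "extend D \<Pi> I = D\<lparr>pred_int := \<lambda>p ds. if p \<in> \<Pi> then (p, ds) \<in> I else pred_int D p ds\<rparr>"

definition extend3 ::
  "('s, 'f, 'p, 'a, 'd) struct3 \<Rightarrow> 'p set \<Rightarrow> ('p \<times> 'd list) set \<times> ('p \<times> 'd list) set \<Rightarrow>
   ('s, 'f, 'p, 'a, 'd) struct3" where
  "extend3 D \<Pi> I = D\<lparr>pred_int3 := \<lambda>p ds. if p \<in> \<Pi> then tv_mem (p, ds) I else pred_int3 D p ds\<rparr>"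

text \<open>The ground instances of a rule are given by the assignments to its variables; the
  arguments of the head are replaced by their values.\<close>

definition ground_head ::
  "('s, 'f, 'd, 'z) algebra_scheme \<Rightarrow> ('s var \<Rightarrow> 'd) \<Rightarrow> ('s, 'f, 'p, 'a) rule \<Rightarrow> 'p \<times> 'd list" where
  "ground_head D v r = (head_pred r, map (trm_val D v) (head_args r))"

definition T_op ::
  "'p set \<Rightarrow> ('s, 'f, 'p, 'a) rule set \<Rightarrow> ('s, 'f, 'p, 'a, 'd) struct \<Rightarrow>
   ('p \<times> 'd list) set \<Rightarrow> ('p \<times> 'd list) set" where
  "T_op \<Pi> P D I =
     {ground_head D v r | v r. v \<in> assignments D \<and> r \<in> P \<and> sat (extend D \<Pi> I) v (body r)}"

definition Phi_op ::
  "('s, 'f, 'p, 'a) signature \<Rightarrow> 'p set \<Rightarrow> ('s, 'f, 'p, 'a) rule set \<Rightarrow>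
   ('s, 'f, 'p, 'a, 'd) struct3 \<Rightarrow>
   ('p \<times> 'd list) set \<times> ('p \<times> 'd list) set \<Rightarrow> ('p \<times> 'd list) set \<times> ('p \<times> 'd list) set" where
  "Phi_op \<Sigma> \<Pi> P D I =
     tv_Collect (ground_atoms \<Sigma> \<Pi> D)
       (\<lambda>A. Sup {val3 (extend3 D \<Pi> I) v (body r) | v r.
                  v \<in> assignments D \<and> r \<in> P \<and> ground_head D v r = A})"

definition well_founded_model ::
  "('s, 'f, 'p, 'a) signature \<Rightarrow> 'p set \<Rightarrow> ('s, 'f, 'p, 'a) rule set \<Rightarrow>
   ('s, 'f, 'p, 'a, 'd) struct3 \<Rightarrow> ('p \<times> 'd list) set \<times> ('p \<times> 'd list) set \<Rightarrow> bool" where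
  "well_founded_model \<Sigma> \<Pi> P D W \<longleftrightarrow>
     well_founded_fixpoint (Pow (ground_atoms \<Sigma> \<Pi> D)) (Phi_op \<Sigma> \<Pi> P D) W"

definition stable_model ::
  "('s, 'f, 'p, 'a) signature \<Rightarrow> 'p set \<Rightarrow> ('s, 'f, 'p, 'a) rule set \<Rightarrow>
   ('s, 'f, 'p, 'a, 'd) struct3 \<Rightarrow> ('p \<times> 'd list) set \<Rightarrow> bool" where
  "stable_model \<Sigma> \<Pi> P D I \<longleftrightarrow>
     stable_fixpoint (Pow (ground_atoms \<Sigma> \<Pi> D)) (Phi_op \<Sigma> \<Pi> P D) (I, I)"

text \<open>\<open>strata_model \<Pi> P D lev i\<close> is \<open>I\<^sub>1 \<union> \<dots> \<union> I\<^sub>i\<close>. The rules of level \<open>i + 1\<close> define the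
  predicates of level \<open>i + 1\<close> over the structure \<open>D\<^sub>i\<close>, in which the predicates of levels
  \<open>1, \<dots>, i\<close> are already interpreted. As \<open>T_op\<close> ignores atoms outside its set of
  defined predicates, the least fixpoint over all sets is that over the interpretations.\<close>

primrec strata_model ::
  "'p set \<Rightarrow> ('s, 'f, 'p, 'a) rule set \<Rightarrow> ('s, 'f, 'p, 'a, 'd) struct \<Rightarrow> ('p \<Rightarrow> nat) \<Rightarrow> nat \<Rightarrow>
   ('p \<times> 'd list) set" where
  "strata_model \<Pi> P D lev 0 = {}"
| "strata_model \<Pi> P D lev (Suc i) =
     strata_model \<Pi> P D lev i \<union>
     lfp (T_op {p \<in> \<Pi>. lev p = Suc i} {r \<in> P. lev (head_pred r) = Suc i}
           (extend D {p \<in> \<Pi>. lev p \<le> i} (strata_model \<Pi> P D lev i)))"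

definition standard_model ::
  "'p set \<Rightarrow> ('s, 'f, 'p, 'a) rule set \<Rightarrow> ('s, 'f, 'p, 'a, 'd) struct \<Rightarrow> ('p \<Rightarrow> nat) \<Rightarrow>
   ('p \<times> 'd list) set" where
  "standard_model \<Pi> P D lev = (\<Union>i. strata_model \<Pi> P D lev i)"

end

theory Submission
  imports Defs
begin

text \<open>In a stratified program the body of a rule for a predicate of level \<open>n\<close> contains
  predicates of level \<open>n\<close> only positively and outside aggregates. Hence on a pair
  \<open>(x, y)\<close> that is exact below level \<open>n\<close> the three-valued operator acts on level \<open>n\<close> as two
  separate copies of the two-valued operator \<open>T\<close>, one on \<open>x\<close> and one on \<open>y\<close>, whatever the
  approximating aggregates are. By induction on the level, any fixpoint \<open>(a, b)\<close> of the stable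
  revision operator agrees with the standard model \<open>M\<close>: both components contain \<open>M\<close> on level \<open>n\<close> by
  the minimality of the stratum, and removing the atoms of level \<open>n\<close> outside \<open>M\<close> from \<open>a\<close>
  or from \<open>b\<close> leaves a prefixpoint of the operator of which \<open>a\<close> or \<open>b\<close> is the least fixpoint.
  So \<open>(M, M)\<close> is the only fixpoint of stable revision.\<close>

section \<open>Stable revision of stratified operators\<close>

text \<open>Knaster-Tarski on the interval \<open>[l, y]\<close>: \<open>f\<close> maps it
  monotonically into itself, so it has a fixpoint there, which lies in \<open>X\<close> and hence
  above \<open>m\<close>. Monotonicity is asked for on the interval only, because the approximating
  operators are controlled only on consistent pairs.\<close>

lemma least_fixpoint_le_prefixpoint:
  fixes f :: "'x set \<Rightarrow> 'x set"
  assumes lfp: "is_least_fixpoint X f m"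
    and interval: "\<And>z. l \<subseteq> z \<Longrightarrow> z \<subseteq> y \<Longrightarrow> z \<in> X"
    and lower: "\<And>z. l \<subseteq> z \<Longrightarrow> z \<subseteq> y \<Longrightarrow> l \<subseteq> f z"
    and mono: "\<And>z z'. l \<subseteq> z \<Longrightarrow> z \<subseteq> z' \<Longrightarrow> z' \<subseteq> y \<Longrightarrow> f z \<subseteq> f z'"
    and "l \<subseteq> y" and "f y \<subseteq> y"
  shows "m \<subseteq> y"
proof -
  \<comment> \<open>Clamping the argument into \<open>[l, y]\<close> makes \<open>g\<close> monotone
    on all sets. Its least fixpoint turns out to lie in the interval, where the clamp is the
    identity and \<open>g\<close> is \<open>f\<close>.\<close>
  define g where "g z = f (l \<union> (z \<inter> y))" for z
  have "mono g"
    unfolding g_def by (intro monoI mono) (use \<open>l \<subseteq> y\<close> in auto)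
  then have fixp: "g (lfp g) = lfp g"
    by (rule lfp_fixpoint)
  have "g y \<subseteq> y"
    using \<open>l \<subseteq> y\<close> \<open>f y \<subseteq> y\<close> by (simp add: g_def Un_absorb1)
  then have le: "lfp g \<subseteq> y"
    by (rule lfp_lowerbound)
  have "l \<subseteq> g (lfp g)"
    unfolding g_def by (rule lower) (use \<open>l \<subseteq> y\<close> in auto)
  then have ge: "l \<subseteq> lfp g"
    by (simp add: fixp)
  then have "l \<union> (lfp g \<inter> y) = lfp g"
    using le by auto
  then have "f (lfp g) = lfp g"
    using fixp by (simp add: g_def)
  then have "m \<subseteq> lfp g"
    using lfp interval[OF ge le] by (auto simp: is_least_fixpoint_def)
  then show ?thesis
    using le by blast
qed

text \<open>The argument about stable revision, freed from syntax: \<open>U\<close> stands for the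
  ground atoms, \<open>A\<close> for the three-valued and \<open>T\<close> for the two-valued
  operator, \<open>M\<close> for the standard model. \<open>A_exact\<close> asks for agreement
  strictly below the level of \<open>e\<close>, leaving \<open>x\<close> and \<open>y\<close> free
  to differ on that level. \<open>M_least\<close> is the minimality of a single stratum, phrased
  with closure under \<open>T\<close> so that it applies to prefixpoints.\<close>

locale stratified_approximation =
  fixes U :: "'x set" and A :: "'x set \<times> 'x set \<Rightarrow> 'x set \<times> 'x set"
    and T :: "'x set \<Rightarrow> 'x set" and l :: "'x \<Rightarrow> nat" and M :: "'x set"
  assumes A_closed: "p \<in> consistent_pairs (Pow U) \<Longrightarrow> A p \<in> consistent_pairs (Pow U)"
    and A_mono: "p \<in> consistent_pairs (Pow U) \<Longrightarrow> q \<in> consistent_pairs (Pow U) \<Longrightarrow>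
      prec_le p q \<Longrightarrow> prec_le (A p) (A q)"
    and A_exact: "(x, y) \<in> consistent_pairs (Pow U) \<Longrightarrow>
      (\<And>e'. e' \<in> U \<Longrightarrow> l e' < l e \<Longrightarrow> e' \<in> x \<longleftrightarrow> e' \<in> y) \<Longrightarrow> e \<in> U \<Longrightarrow>
      (e \<in> fst (A (x, y)) \<longleftrightarrow> e \<in> T x) \<and> (e \<in> snd (A (x, y)) \<longleftrightarrow> e \<in> T y)"
    and T_local: "x \<subseteq> U \<Longrightarrow> y \<subseteq> U \<Longrightarrow>
      (\<And>e'. e' \<in> U \<Longrightarrow> l e' \<le> l e \<Longrightarrow> e' \<in> x \<longleftrightarrow> e' \<in> y) \<Longrightarrow> e \<in> U \<Longrightarrow>
      e \<in> T x \<longleftrightarrow> e \<in> T y"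
    and M_sub: "M \<subseteq> U"
    and M_fix: "e \<in> U \<Longrightarrow> e \<in> T M \<longleftrightarrow> e \<in> M"
    and M_least: "x \<subseteq> U \<Longrightarrow> (\<And>e'. e' \<in> U \<Longrightarrow> l e' < n \<Longrightarrow> e' \<in> x \<longleftrightarrow> e' \<in> M) \<Longrightarrow>
      (\<And>e'. e' \<in> U \<Longrightarrow> l e' = n \<Longrightarrow> e' \<in> T x \<Longrightarrow> e' \<in> x) \<Longrightarrow> e \<in> M \<Longrightarrow> l e = n \<Longrightarrow> e \<in> x"
begin

lemma A_exact_pair: "A (M, M) = (M, M)"
proof -
  have "(M, M) \<in> consistent_pairs (Pow U)"
    using M_sub by (auto simp: consistent_pairs_def)
  note closed = A_closed[OF this] and exact = A_exact[OF this]
  have "fst (A (M, M)) \<subseteq> U" "snd (A (M, M)) \<subseteq> U"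
    using closed by (auto simp: consistent_pairs_def)
  then have "fst (A (M, M)) = M" "snd (A (M, M)) = M"
    using exact M_fix M_sub by blast+
  then show ?thesis
    by (simp add: prod_eq_iff)
qed

text \<open>Leastness needs an argument for the lower component only, since every candidate for the
  upper one contains \<open>M\<close> by the choice of interval. A fixpoint \<open>x\<close> below
  \<open>M\<close> regains \<open>M\<close> level by level: once it agrees with \<open>M\<close>
  below level \<open>n\<close>, exactness makes it closed under \<open>T\<close> on level
  \<open>n\<close>.\<close>

lemma stable_revision_model: "stable_revision (Pow U) A (M, M) (M, M)"
proof -
  have "M \<subseteq> x" if x: "x \<subseteq> M" and fixp: "fst (A (x, M)) = x" for x
  proof -
    have cons: "(x, M) \<in> consistent_pairs (Pow U)"
      using x M_sub by (auto simp: consistent_pairs_def)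
    have "\<forall>e\<in>M. l e = n \<longrightarrow> e \<in> x" for n
    proof (induction n rule: less_induct)
      case (less n)
      then have below: "e' \<in> x \<longleftrightarrow> e' \<in> M" if "l e' < n" for e'
        using that x by auto
      have "e \<in> x" if "e \<in> U" "l e = n" "e \<in> T x" for e
        using A_exact[OF cons, of e] below that fixp by simp
      then show ?case
        using M_least[of x n] below x M_sub by blast
    qed
    then show ?thesis by blast
  qed
  then show ?thesis
    using A_exact_pair M_sub by (auto simp: stable_revision_def is_least_fixpoint_def)
qed

lemma stable_revision_unique:
  assumes ab: "(a, b) \<in> consistent_pairs (Pow U)"
    and rev: "stable_revision (Pow U) A (a, b) (a, b)"
  shows "(a, b) = (M, M)"
proof -
  have sub: "a \<subseteq> b" "a \<subseteq> U" "b \<subseteq> U"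
    using ab by (auto simp: consistent_pairs_def)
  have lfp_a: "is_least_fixpoint {x \<in> Pow U. x \<subseteq> b} (\<lambda>x. fst (A (x, b))) a"
    and lfp_b: "is_least_fixpoint {y \<in> Pow U. a \<subseteq> y} (\<lambda>y. snd (A (a, y))) b"
    using rev by (auto simp: stable_revision_def)
  then have fix_a: "fst (A (a, b)) = a" and fix_b: "snd (A (a, b)) = b"
    by (auto simp: is_least_fixpoint_def)
  have mono1: "fst (A (x, y)) \<subseteq> fst (A (x', y'))"
    and mono2: "snd (A (x', y')) \<subseteq> snd (A (x, y))"
    if "x \<subseteq> x'" "x' \<subseteq> y'" "y' \<subseteq> y" "y \<subseteq> U" for x x' y y'
    using A_mono[of "(x, y)" "(x', y')"] that by (auto simp: prec_le_def consistent_pairs_def)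
  have "\<forall>e\<in>U. l e = n \<longrightarrow> (e \<in> a \<longleftrightarrow> e \<in> M) \<and> (e \<in> b \<longleftrightarrow> e \<in> M)" for n
  proof (induction n rule: less_induct)
    case (less n)
    have exact: "(e \<in> fst (A (x, y)) \<longleftrightarrow> e \<in> T x) \<and> (e \<in> snd (A (x, y)) \<longleftrightarrow> e \<in> T y)"
      if "x \<subseteq> y" "y \<subseteq> U" "e \<in> U" "l e = n"
        "\<And>e'. e' \<in> U \<Longrightarrow> l e' < n \<Longrightarrow> e' \<in> x \<longleftrightarrow> e' \<in> M"
        "\<And>e'. e' \<in> U \<Longrightarrow> l e' < n \<Longrightarrow> e' \<in> y \<longleftrightarrow> e' \<in> M" for x y e
      using that by (intro A_exact) (auto simp: consistent_pairs_def)
    have below_a: "e \<in> a \<longleftrightarrow> e \<in> M" and below_b: "e \<in> b \<longleftrightarrow> e \<in> M"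
      if "e \<in> U" "l e < n" for e
      using less that by auto
    have step: "e \<in> a \<longleftrightarrow> e \<in> T a" "e \<in> b \<longleftrightarrow> e \<in> T b" if "e \<in> U" "l e = n" for e
      using exact[of a b e] sub that below_a below_b fix_a fix_b by auto
    \<comment> \<open>By \<open>step\<close>, \<open>a\<close> and \<open>b\<close> are closed under
      \<open>T\<close> on level \<open>n\<close>, so the minimality of the stratum applies to
      each.\<close>
    have M_a: "e \<in> a" and M_b: "e \<in> b" if "e \<in> M" "l e = n" for e
      using M_least[of a n] M_least[of b n] that step below_a below_b sub by blast+
    have T_eq: "e \<in> T x \<longleftrightarrow> e \<in> M"
      if "x \<subseteq> U" "e \<in> U" "l e = n" "\<And>e'. e' \<in> U \<Longrightarrow> l e' \<le> n \<Longrightarrow> e' \<in> x \<longleftrightarrow> e' \<in> M" for x e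
      using T_local[of x M e] M_fix[of e] M_sub that by auto
    \<comment> \<open>Only the surplus atoms of level \<open>n\<close> are removed. Higher levels
      stay as they are, so that for them the prefixpoint property is inherited from \<open>a\<close>
      and \<open>b\<close> by monotonicity.\<close>
    define x where "x = {e \<in> a. l e = n \<longrightarrow> e \<in> M}"
    define y where "y = {e \<in> b. l e = n \<longrightarrow> e \<in> M}"
    have x_M: "e \<in> x \<longleftrightarrow> e \<in> M" and y_M: "e \<in> y \<longleftrightarrow> e \<in> M" if "e \<in> U" "l e \<le> n" for e
      using that below_a below_b M_a M_b by (auto simp: x_def y_def le_less)
    have "a \<subseteq> x"
    proof (rule least_fixpoint_le_prefixpoint[OF lfp_a, of "{}"])
      have "x \<subseteq> a"
        by (auto simp: x_def)
      show "fst (A (x, b)) \<subseteq> x"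
      proof
        fix e assume e: "e \<in> fst (A (x, b))"
        have "e \<in> a"
          using mono1[of x a b b] e fix_a sub by (auto simp: x_def)
        \<comment> \<open>On level \<open>n\<close> the operator acts as \<open>T\<close> on
          \<open>x\<close>, and \<open>x\<close> agrees with \<open>M\<close> up to level
          \<open>n\<close>, so nothing outside \<open>M\<close> is derived.\<close>
        moreover have "e \<in> M" if "l e = n"
          using exact[of x b e] T_eq[of x e] x_M below_b e that \<open>e \<in> a\<close> \<open>x \<subseteq> a\<close> sub by auto
        ultimately show "e \<in> x"
          by (simp add: x_def)
      qed
      show "fst (A (z, b)) \<subseteq> fst (A (z', b))" if "z \<subseteq> z'" "z' \<subseteq> x" for z z'
        using mono1[of z z' b b] that \<open>x \<subseteq> a\<close> sub by auto
    qed (use sub in \<open>auto simp: x_def\<close>)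
    then have a_x: "a = x"
      by (auto simp: x_def)
    have "b \<subseteq> y"
    proof (rule least_fixpoint_le_prefixpoint[OF lfp_b, of a])
      \<comment> \<open>The interval for the upper component starts at \<open>a\<close>, so
        \<open>a\<close> must already be free of surplus atoms; hence the lower component comes
        first.\<close>
      show "a \<subseteq> y"
        using a_x sub by (auto simp: x_def y_def)
      have "y \<subseteq> b"
        by (auto simp: y_def)
      \<comment> \<open>Shrinking \<open>b\<close> to \<open>z\<close> makes the pair more precise,
        which keeps \<open>a = fst (A (a, b))\<close> below \<open>fst (A (a, z))\<close>;
        consistency of \<open>A (a, z)\<close> carries this to the second component.\<close>
      show "a \<subseteq> snd (A (a, z))" if "a \<subseteq> z" "z \<subseteq> y" for z
      proof -
        have "z \<subseteq> b" "z \<subseteq> U"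
          using that \<open>y \<subseteq> b\<close> sub by auto
        then have "a \<subseteq> fst (A (a, z))"
          using mono1[of a a z b] that fix_a sub by auto
        also have "\<dots> \<subseteq> snd (A (a, z))"
          using A_closed[of "(a, z)"] that \<open>z \<subseteq> U\<close> sub by (auto simp: consistent_pairs_def)
        finally show ?thesis .
      qed
      show "snd (A (a, y)) \<subseteq> y"
      proof
        fix e assume e: "e \<in> snd (A (a, y))"
        have "e \<in> b"
          using mono2[of a a y b] e fix_b sub \<open>a \<subseteq> y\<close> \<open>y \<subseteq> b\<close> by auto
        moreover have "y \<subseteq> U" "e \<in> U"
          using \<open>e \<in> b\<close> \<open>y \<subseteq> b\<close> sub by auto
        then have "e \<in> M" if "l e = n"
          using exact[of a y e] T_eq[of y e] y_M below_a e that \<open>a \<subseteq> y\<close>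
          by auto
        ultimately show "e \<in> y"
          by (simp add: y_def)
      qed
      show "snd (A (a, z)) \<subseteq> snd (A (a, z'))" if "a \<subseteq> z" "z \<subseteq> z'" "z' \<subseteq> y" for z z'
        using mono2[of a a z z'] that \<open>y \<subseteq> b\<close> sub by auto
    qed (use sub in \<open>auto simp: y_def\<close>)
    then have "b = y"
      by (auto simp: y_def)
    then show ?case
      using a_x x_M y_M by auto
  qed
  then show ?thesis
    using sub M_sub by blast
qed

lemma reliable_model: "reliable (Pow U) A (M, M)"
  using M_sub by (simp add: reliable_def A_exact_pair prec_le_def consistent_pairs_def)

lemma stable_fixpoint_iff: "stable_fixpoint (Pow U) A p \<longleftrightarrow> p = (M, M)"
  using stable_revision_unique[of "fst p" "snd p"] stable_revision_model reliable_model
  by (auto simp: stable_fixpoint_def reliable_def)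

text \<open>A reliable fixpoint of stable revision is prudent with itself as the witness, so these
  pairs are exactly the stable fixpoints.\<close>

lemma prudent_fixpoint_iff:
  "prudent (Pow U) A p \<and> stable_revision (Pow U) A p p \<longleftrightarrow> p = (M, M)"
  using stable_fixpoint_iff[of p] by (auto simp: stable_fixpoint_def prudent_def)

lemma well_founded_fixpoint_iff: "well_founded_fixpoint (Pow U) A p \<longleftrightarrow> p = (M, M)"
  unfolding well_founded_fixpoint_def conj_assoc[symmetric] prudent_fixpoint_iff
  by (auto simp: prec_le_def)

end


section \<open>Evaluation of formulas\<close>

lemma dom_of_extend [simp]: "dom_of (extend D \<Pi> I) = dom_of D"
  and fun_int_extend [simp]: "fun_int (extend D \<Pi> I) = fun_int D"
  and agg_int_extend [simp]: "agg_int (extend D \<Pi> I) = agg_int D"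
  and pred_int_extend [simp]:
    "pred_int (extend D \<Pi> I) p ds = (if p \<in> \<Pi> then (p, ds) \<in> I else pred_int D p ds)"
  and dom_of_extend3 [simp]: "dom_of (extend3 D3 \<Pi> J) = dom_of D3"
  and fun_int_extend3 [simp]: "fun_int (extend3 D3 \<Pi> J) = fun_int D3"
  and agg_int3_extend3 [simp]: "agg_int3 (extend3 D3 \<Pi> J) = agg_int3 D3"
  and pred_int3_extend3 [simp]: "pred_int3 (extend3 D3 \<Pi> J) p ds =
    (if p \<in> \<Pi> then tv_mem (p, ds) J else pred_int3 D3 p ds)"
  by (simp_all add: extend_def extend3_def)

lemma tuples_cong: "dom_of D = dom_of D' \<Longrightarrow> tuples D = tuples D'"
  by (simp add: tuples_def fun_eq_iff)

lemma trm_val_cong: "fun_int D = fun_int D' \<Longrightarrow> trm_val D v t = trm_val D' v t"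
  by (induction t) (auto cong: map_cong)

lemma tuples_extend [simp]: "tuples (extend D \<Pi> I) = tuples D"
  and tuples_extend3 [simp]: "tuples (extend3 D3 \<Pi> J) = tuples D3"
  by (rule tuples_cong, simp)+

lemma trm_val_extend [simp]: "trm_val (extend D \<Pi> I) = trm_val D"
  and trm_val_extend3 [simp]: "trm_val (extend3 D3 \<Pi> J) = trm_val D3"
  by (intro ext trm_val_cong, simp)+

lemma assignments_extend [simp]: "assignments (extend D \<Pi> I) = assignments D"
  by (simp add: assignments_def)

lemma ground_head_extend [simp]: "ground_head (extend D \<Pi> I) = ground_head D"
  by (simp add: ground_head_def fun_eq_iff)

lemma tuples_map: "(\<And>t. t \<in> set ts \<Longrightarrow> f t \<in> dom_of D (g t)) \<Longrightarrow> map f ts \<in> tuples D (map g ts)"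
  by (auto simp: tuples_def list_all2_conv_all_nth)

lemma trm_val_in_dom:
  assumes "is_algebra \<Sigma> D" "v \<in> assignments D" "wf_trm \<Sigma> t"
  shows "trm_val D v t \<in> dom_of D (sort_of \<Sigma> t)"
  using assms(3)
proof (induction t)
  case (Var x)
  then show ?case using assms(2) by (simp add: assignments_def del: split_paired_All)
next
  case (Fun f ts)
  then have "map (trm_val D v) ts \<in> tuples D (map (sort_of \<Sigma>) ts)"
    by (intro tuples_map) auto
  then show ?case
    using Fun.prems assms(1) by (simp add: is_algebra_def)
qed

lemma assignments_upd:
  "v \<in> assignments D \<Longrightarrow> d \<in> dom_of D (snd x) \<Longrightarrow> v(x := d) \<in> assignments D"
  by (auto simp: assignments_def)

lemma assignments_upds:
  assumes "v \<in> assignments D" "ds \<in> tuples D (map snd xs)"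
  shows "upds v xs ds \<in> assignments D"
proof -
  have "d \<in> dom_of D (snd x)" if "map_of (zip xs ds) x = Some d" for x d
    using map_of_SomeD[OF that] assms(2)
    by (auto simp: tuples_def list_all2_conv_all_nth in_set_zip)
  then show ?thesis
    using assms(1) by (auto simp: assignments_def upds_def split: option.split)
qed

text \<open>The polarity \<open>b\<close> is left free because \<open>Neg\<close> exchanges the two
  occurrence sets and because aggregate bodies are later treated under both polarities.\<close>

lemma fm_preds_eq: "fm_preds \<phi> = occurs b \<phi> \<union> occurs (\<not> b) \<phi> \<union> occurs_agg \<phi>"
  by (induction \<phi> arbitrary: b) (auto split: if_splits)

lemma sat_pred_int_cong:
  assumes "\<And>p ds. p \<in> fm_preds \<phi> \<Longrightarrow> pred_int D p ds = pred_int D' p ds"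
    and "dom_of D = dom_of D'" "fun_int D = fun_int D'" "agg_int D = agg_int D'"
  shows "sat D v \<phi> = sat D' v \<phi>"
proof -
  note [simp] = tuples_cong[OF assms(2)] assms(2,4)
  have [simp]: "trm_val D = trm_val D'"
    using trm_val_cong[OF assms(3)] by (intro ext)
  show ?thesis
    using assms(1) by (induction \<phi> arbitrary: v) auto
qed

text \<open>A truth value is determined by whether it is \<open>TTrue\<close> and whether it is
  \<open>TFalse\<close>. These two classical tests reduce Kleene's logic to two-valued
  reasoning.\<close>

lemma tv_simps [simp]:
  "inf x y = TTrue \<longleftrightarrow> x = TTrue \<and> y = TTrue"
  "inf x y = TFalse \<longleftrightarrow> x = TFalse \<or> y = TFalse"
  "sup x y = TTrue \<longleftrightarrow> x = TTrue \<or> y = TTrue"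
  "sup x y = TFalse \<longleftrightarrow> x = TFalse \<and> y = TFalse"
  "- x = TTrue \<longleftrightarrow> x = TFalse"
  "- x = TFalse \<longleftrightarrow> x = TTrue"
  "tv_of_bool c = TTrue \<longleftrightarrow> c"
  "tv_of_bool c = TFalse \<longleftrightarrow> \<not> c"
  by (cases x; cases y; simp add: inf_tv_def sup_tv_def less_eq_tv_def tv_of_bool_def)+

lemma Inf_tv_eq [simp]:
  "Inf X = TTrue \<longleftrightarrow> (\<forall>x\<in>X. x = TTrue)" "Inf X = TFalse \<longleftrightarrow> TFalse \<in> X"
  unfolding Inf_tv_def by (auto, metis tv.exhaust)

lemma Sup_tv_eq [simp]:
  "Sup X = TTrue \<longleftrightarrow> TTrue \<in> X" "Sup X = TFalse \<longleftrightarrow> (\<forall>x\<in>X. x = TFalse)"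
  unfolding Sup_tv_def by (auto, metis tv.exhaust)

lemma tv_prec_iff: "tv_prec x y \<longleftrightarrow> (x = TTrue \<longrightarrow> y = TTrue) \<and> (x = TFalse \<longrightarrow> y = TFalse)"
  by (cases x; cases y; simp add: tv_prec_def)

lemma tv_mem_eq:
  "tv_mem e J = TTrue \<longleftrightarrow> e \<in> fst J" "tv_mem e J = TFalse \<longleftrightarrow> e \<notin> fst J \<and> e \<notin> snd J"
  by (auto simp: tv_mem_def)

lemma tv_Collect_consistent: "tv_Collect U f \<in> consistent_pairs (Pow U)"
  by (auto simp: tv_Collect_def consistent_pairs_def)

lemma tv_Collect_mono:
  "(\<And>x. x \<in> U \<Longrightarrow> tv_prec (f x) (g x)) \<Longrightarrow> prec_le (tv_Collect U f) (tv_Collect U g)"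
  by (auto simp: tv_Collect_def prec_le_def tv_prec_iff)

lemma tv_Collect_cong:
  "(\<And>x. x \<in> U \<Longrightarrow> f x = TTrue \<longleftrightarrow> Q x) \<Longrightarrow> (\<And>x. x \<in> U \<Longrightarrow> f x \<noteq> TFalse \<longleftrightarrow> Q x) \<Longrightarrow>
    tv_Collect U f = ({x \<in> U. Q x}, {x \<in> U. Q x})"
  by (auto simp: tv_Collect_def)

section \<open>Kleene evaluation in an approximating structure\<close>

locale approximation =
  fixes \<Sigma> :: "('s, 'f, 'p, 'a) signature" and \<Pi> :: "'p set"
    and D :: "('s, 'f, 'p, 'a, 'd) struct" and D3 :: "('s, 'f, 'p, 'a, 'd) struct3"
  assumes algebra: "is_algebra \<Sigma> D" and approx: "approximates \<Sigma> \<Pi> D3 D"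
begin

lemma dom_of_D3 [simp]: "dom_of D3 = dom_of D"
  using approx by (simp add: approximates_def)

lemma tuples_D3 [simp]: "tuples D3 = tuples D"
  by (rule tuples_cong) simp

lemma assignments_D3 [simp]: "assignments D3 = assignments D"
  by (simp add: assignments_def)

text \<open>The two structures share function values only on arguments from the right domains;
  well-sortedness keeps all arguments there.\<close>

lemma trm_val_D3:
  assumes "v \<in> assignments D" "wf_trm \<Sigma> t"
  shows "trm_val D3 v t = trm_val D v t"
  using assms(2)
proof (induction t)
  case (Fun f ts)
  then have eq: "map (trm_val D3 v) ts = map (trm_val D v) ts"
    by auto
  have "map (trm_val D v) ts \<in> tuples D (map (sort_of \<Sigma>) ts)"
    using Fun.prems trm_val_in_dom[OF algebra assms(1)] by (intro tuples_map) auto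
  then have "fun_int D3 f (map (trm_val D v) ts) = fun_int D f (map (trm_val D v) ts)"
    using Fun.prems approx by (simp add: approximates_def)
  then show ?case
    by (simp only: trm_val.simps eq)
qed simp

lemma map_trm_val_D3:
  assumes "v \<in> assignments D" "wf_atom \<Sigma> p ts"
  shows "map (trm_val D3 v) ts = map (trm_val D v) ts"
  using assms by (auto simp: wf_atom_def trm_val_D3)

lemma map_trm_val_in_tuples:
  assumes "v \<in> assignments D" "wf_atom \<Sigma> p ts"
  shows "map (trm_val D v) ts \<in> tuples D (pred_args \<Sigma> p)"
proof -
  have "map (trm_val D v) ts \<in> tuples D (map (sort_of \<Sigma>) ts)"
    using assms trm_val_in_dom[OF algebra assms(1)] by (intro tuples_map) (auto simp: wf_atom_def)
  then show ?thesis
    using assms by (simp add: wf_atom_def)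
qed

lemma agg_int3_mono:
  assumes "X \<in> consistent_pairs (Pow (tuples D (agg_set \<Sigma> R)))"
    "Y \<in> consistent_pairs (Pow (tuples D (agg_set \<Sigma> R)))"
    "d \<in> dom_of D (agg_elem \<Sigma> R)" "prec_le X Y"
  shows "tv_prec (agg_int3 D3 R X d) (agg_int3 D3 R Y d)"
  using approx assms unfolding approximates_def three_valued_aggregate_def by blast

lemma agg_int3_exact:
  assumes "S \<subseteq> tuples D (agg_set \<Sigma> R)" "d \<in> dom_of D (agg_elem \<Sigma> R)"
  shows "agg_int3 D3 R (S, S) d = tv_of_bool (agg_int D R S d)"
  using approx assms unfolding approximates_def by blast

text \<open>Kleene's connectives and quantifiers preserve precision, and so do three-valued
  aggregate relations on sets of the right sort. Consistency of \<open>K\<close>, which entails that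
  of \<open>J\<close>, serves the atoms: one false in \<open>J\<close> has to be outside both
  components of \<open>K\<close>.\<close>

lemma val3_mono:
  assumes "prec_le J K" "fst K \<subseteq> snd K" "v \<in> assignments D" "wf_fm \<Sigma> \<phi>"
  shows "tv_prec (val3 (extend3 D3 \<Pi> J) v \<phi>) (val3 (extend3 D3 \<Pi> K) v \<phi>)"
  using assms(3,4)
proof (induction \<phi> arbitrary: v)
  case (Atom p ts)
  then show ?case
    using assms(1,2) by (auto simp: tv_mem_eq tv_prec_iff prec_le_def)
next
  case (Forall x \<phi>)
  have "tv_prec (val3 (extend3 D3 \<Pi> J) (v(x := d)) \<phi>) (val3 (extend3 D3 \<Pi> K) (v(x := d)) \<phi>)"
    if "d \<in> dom_of D (snd x)" for d
    using Forall that by (intro Forall.IH assignments_upd) auto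
  then show ?case
    by (auto simp: tv_prec_iff image_iff eq_commute[of TFalse])
next
  case (Exists x \<phi>)
  have "tv_prec (val3 (extend3 D3 \<Pi> J) (v(x := d)) \<phi>) (val3 (extend3 D3 \<Pi> K) (v(x := d)) \<phi>)"
    if "d \<in> dom_of D (snd x)" for d
    using Exists that by (intro Exists.IH assignments_upd) auto
  then show ?case
    by (auto simp: tv_prec_iff image_iff eq_commute[of TTrue])
next
  case (Agg R xs \<psi> t)
  have xs: "map snd xs = agg_set \<Sigma> R" and wf: "wf_fm \<Sigma> \<psi>"
    and t: "trm_val D3 v t \<in> dom_of D (agg_elem \<Sigma> R)"
    using Agg.prems trm_val_in_dom[OF algebra Agg.prems(1), of t] by (auto simp: trm_val_D3)
  have "tv_prec (val3 (extend3 D3 \<Pi> J) (upds v xs ds) \<psi>) (val3 (extend3 D3 \<Pi> K) (upds v xs ds) \<psi>)"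
    if "ds \<in> tuples D (agg_set \<Sigma> R)" for ds
    using Agg.IH[OF assignments_upds wf] Agg.prems(1) that xs by simp
  then show ?case
    using t by (auto simp: xs intro!: agg_int3_mono tv_Collect_consistent tv_Collect_mono)
qed (auto simp: tv_prec_iff)

text \<open>Certain truth is read off \<open>x\<close> and possible truth off \<open>y\<close> as
  long as everything of the opposite polarity or inside an aggregate is exact. The flag
  \<open>b\<close> is the polarity of the context: \<open>Neg\<close> exchanges certainty with
  impossibility, hence \<open>x\<close> with \<open>y\<close>, and flips \<open>b\<close>.\<close>

lemma val3_exact:
  assumes "x \<subseteq> y" "v \<in> assignments D" "wf_fm \<Sigma> \<phi>"
    and "\<And>p ds. p \<in> \<Pi> \<Longrightarrow> p \<in> occurs (\<not> b) \<phi> \<union> occurs_agg \<phi> \<Longrightarrow> (p, ds) \<in> x \<longleftrightarrow> (p, ds) \<in> y"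
  shows "(val3 (extend3 D3 \<Pi> (x, y)) v \<phi> = TTrue \<longleftrightarrow>
            sat (extend D \<Pi> (if b then x else y)) v \<phi>) \<and>
         (val3 (extend3 D3 \<Pi> (x, y)) v \<phi> \<noteq> TFalse \<longleftrightarrow>
            sat (extend D \<Pi> (if b then y else x)) v \<phi>)"
proof -
  let ?exact = "\<lambda>b v \<phi>. (val3 (extend3 D3 \<Pi> (x, y)) v \<phi> = TTrue \<longleftrightarrow>
                          sat (extend D \<Pi> (if b then x else y)) v \<phi>) \<and>
                       (val3 (extend3 D3 \<Pi> (x, y)) v \<phi> \<noteq> TFalse \<longleftrightarrow>
                          sat (extend D \<Pi> (if b then y else x)) v \<phi>)"
  show ?thesis
    using assms(2-4)
  proof (induction \<phi> arbitrary: v b)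
    case (Eq t u)
    then show ?case by (simp add: trm_val_D3)
  next
    case (Atom p ts)
    note mem = map_trm_val_in_tuples[OF Atom.prems(1), of p ts]
    show ?case
    proof (cases "p \<in> \<Pi>")
      case True
      then show ?thesis
        using Atom.prems \<open>x \<subseteq> y\<close>
        by (auto simp: tv_mem_eq map_trm_val_D3)
    next
      case False
      then show ?thesis
        using Atom.prems mem approx
        by (auto simp: approximates_def map_trm_val_D3)
    qed
  next
    case (Neg \<phi>)
    have "?exact (\<not> b) v \<phi>"
      by (rule Neg.IH) (use Neg.prems in auto)
    then show ?case
      by auto
  next
    case (Conj \<phi> \<psi>)
    have "?exact b v \<phi>"
      by (rule Conj.IH(1)) (use Conj.prems in auto)
    moreover have "?exact b v \<psi>"
      by (rule Conj.IH(2)) (use Conj.prems in auto)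
    ultimately show ?case
      by simp
  next
    case (Disj \<phi> \<psi>)
    have "?exact b v \<phi>"
      by (rule Disj.IH(1)) (use Disj.prems in auto)
    moreover have "?exact b v \<psi>"
      by (rule Disj.IH(2)) (use Disj.prems in auto)
    ultimately show ?case
      by simp
  next
    case (Forall z \<phi>)
    have "?exact b (v(z := d)) \<phi>" if "d \<in> dom_of D (snd z)" for d
      using Forall that by (intro Forall.IH assignments_upd) auto
    then show ?case
      by (auto simp del: fun_upd_apply simp: image_iff eq_commute[of TFalse])
  next
    case (Exists z \<phi>)
    have "?exact b (v(z := d)) \<phi>" if "d \<in> dom_of D (snd z)" for d
      using Exists that by (intro Exists.IH assignments_upd) auto
    then show ?case
      by (auto simp del: fun_upd_apply simp: image_iff eq_commute[of TTrue])
  next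
    case (Agg R xs \<psi> t)
    have xs: "map snd xs = agg_set \<Sigma> R"
      and t: "trm_val D3 v t = trm_val D v t" "trm_val D v t \<in> dom_of D (agg_elem \<Sigma> R)"
      using Agg.prems trm_val_in_dom[OF algebra Agg.prems(1), of t] by (auto simp: trm_val_D3)
    \<comment> \<open>All predicates of \<open>\<psi>\<close> lie inside the aggregate, where
      \<open>x\<close> and \<open>y\<close> agree, so the induction hypothesis is available for both
      polarities.\<close>
    have IH: "?exact c (upds v xs ds) \<psi>"
      if "ds \<in> tuples D (agg_set \<Sigma> R)" for ds c
      using Agg.prems that xs fm_preds_eq[of \<psi> c]
      by (intro Agg.IH assignments_upds) auto
    \<comment> \<open>The opposite polarity ties possible membership to the same structure to which
      \<open>c\<close> ties certain membership. The three-valued set is therefore of the form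
      \<open>(S, S)\<close>, on which every approximating aggregate relation has the two-valued
      result.\<close>
    have "val3 (extend3 D3 \<Pi> (x, y)) (upds v xs ds) \<psi> \<noteq> TFalse \<longleftrightarrow>
        sat (extend D \<Pi> (if c then x else y)) (upds v xs ds) \<psi>"
      if "ds \<in> tuples D (agg_set \<Sigma> R)" for ds c
      using IH[OF that, of "\<not> c"] by (cases c) simp_all
    then have eq: "tv_Collect (tuples D (agg_set \<Sigma> R))
        (\<lambda>ds. val3 (extend3 D3 \<Pi> (x, y)) (upds v xs ds) \<psi>) =
      ({ds \<in> tuples D (agg_set \<Sigma> R). sat (extend D \<Pi> (if c then x else y)) (upds v xs ds) \<psi>},
       {ds \<in> tuples D (agg_set \<Sigma> R). sat (extend D \<Pi> (if c then x else y)) (upds v xs ds) \<psi>})" for c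
      using IH by (intro tv_Collect_cong) blast+
    have "val3 (extend3 D3 \<Pi> (x, y)) v (Agg R xs \<psi> t) =
        tv_of_bool (sat (extend D \<Pi> (if c then x else y)) v (Agg R xs \<psi> t))" for c
      using t by (simp add: xs agg_int3_exact eq[of c])
    from this[of b] this[of "\<not> b"] show ?case
      by (cases b) (auto simp: tv_of_bool_def simp del: val3.simps sat.simps split: if_splits)
  qed auto
qed

end


section \<open>Stratified programs\<close>

locale stratified_program = approximation \<Sigma> \<Pi> D D3
  for \<Sigma> :: "('s, 'f, 'p, 'a) signature" and \<Pi> :: "'p set"
    and D :: "('s, 'f, 'p, 'a, 'd) struct" and D3 :: "('s, 'f, 'p, 'a, 'd) struct3" +
  fixes P :: "('s, 'f, 'p, 'a) rule set" and lev :: "'p \<Rightarrow> nat"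
  assumes program: "aggregate_program \<Sigma> \<Pi> P" and strat: "stratification \<Pi> P lev"
begin

abbreviation "U \<equiv> ground_atoms \<Sigma> \<Pi> D"
abbreviation "T \<equiv> T_op \<Pi> P D"
abbreviation "\<Phi> \<equiv> Phi_op \<Sigma> \<Pi> P D3"
abbreviation "lv e \<equiv> lev (fst e)"

section \<open>Consequence operators of a stratified program\<close>

lemma wf_rule:
  assumes "r \<in> P"
  shows "head_pred r \<in> \<Pi>" "wf_atom \<Sigma> (head_pred r) (head_args r)" "wf_fm \<Sigma> (body r)"
  using program assms by (auto simp: aggregate_program_def)

lemma lev_body:
  assumes "r \<in> P" "q \<in> \<Pi>"
  shows "q \<in> occurs False (body r) \<union> occurs_agg (body r) \<Longrightarrow> lev q < lev (head_pred r)"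
    and "q \<in> fm_preds (body r) \<Longrightarrow> lev q \<le> lev (head_pred r)"
proof -
  show lt: "lev q < lev (head_pred r)" if "q \<in> occurs False (body r) \<union> occurs_agg (body r)"
    using strat assms that unfolding stratification_def by blast
  have "lev q \<le> lev (head_pred r)" if "q \<in> occurs True (body r)"
    using strat assms that unfolding stratification_def by blast
  with lt show "q \<in> fm_preds (body r) \<Longrightarrow> lev q \<le> lev (head_pred r)"
    using fm_preds_eq[of "body r" True] by fastforce
qed

lemma lev_pos: "e \<in> U \<Longrightarrow> lv e > 0"
  using strat by (auto simp: stratification_def ground_atoms_def)

lemma ground_atoms_D3: "ground_atoms \<Sigma> \<Pi> D3 = U"
  by (simp add: ground_atoms_def)

lemma ground_head_in_atoms: "v \<in> assignments D \<Longrightarrow> r \<in> P \<Longrightarrow> ground_head D v r \<in> U"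
  using wf_rule map_trm_val_in_tuples by (auto simp: ground_head_def ground_atoms_def)

lemma ground_head_D3: "v \<in> assignments D \<Longrightarrow> r \<in> P \<Longrightarrow> ground_head D3 v r = ground_head D v r"
  by (simp only: ground_head_def map_trm_val_D3[OF _ wf_rule(2)])

lemma T_iff:
  "e \<in> T x \<longleftrightarrow> (\<exists>v r. v \<in> assignments D \<and> r \<in> P \<and> ground_head D v r = e \<and>
                   sat (extend D \<Pi> x) v (body r))"
  by (auto simp: T_op_def)

text \<open>A join in the truth order is true iff some member is, and not false iff some member is
  not. The restriction to ground atoms is absorbed since rule heads are well-sorted.\<close>

lemma Phi_iff:
  "e \<in> fst (\<Phi> J) \<longleftrightarrow> (\<exists>v r. v \<in> assignments D \<and> r \<in> P \<and> ground_head D v r = e \<and>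
                          val3 (extend3 D3 \<Pi> J) v (body r) = TTrue)"
  "e \<in> snd (\<Phi> J) \<longleftrightarrow> (\<exists>v r. v \<in> assignments D \<and> r \<in> P \<and> ground_head D v r = e \<and>
                          val3 (extend3 D3 \<Pi> J) v (body r) \<noteq> TFalse)"
  using ground_head_in_atoms ground_head_D3
  by (auto simp: Phi_op_def tv_Collect_def ground_atoms_D3) (metis ground_head_D3)+

lemma T_sub: "T x \<subseteq> U"
  using ground_head_in_atoms unfolding subset_iff T_iff by blast

text \<open>Stratification puts every predicate with a negative or aggregate occurrence strictly
  below the head, so agreement there is what \<open>val3_exact\<close> asks for in a positive
  context.\<close>

lemma body_exact:
  assumes "x \<subseteq> y" "v \<in> assignments D" "r \<in> P"
    and below: "\<And>e. fst e \<in> \<Pi> \<Longrightarrow> lv e < lev (head_pred r) \<Longrightarrow> e \<in> x \<longleftrightarrow> e \<in> y"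
  shows "val3 (extend3 D3 \<Pi> (x, y)) v (body r) = TTrue \<longleftrightarrow> sat (extend D \<Pi> x) v (body r)"
    and "val3 (extend3 D3 \<Pi> (x, y)) v (body r) \<noteq> TFalse \<longleftrightarrow> sat (extend D \<Pi> y) v (body r)"
proof -
  have "(p, ds) \<in> x \<longleftrightarrow> (p, ds) \<in> y"
    if "p \<in> \<Pi>" "p \<in> occurs (\<not> True) (body r) \<union> occurs_agg (body r)" for p ds
    using lev_body(1)[OF \<open>r \<in> P\<close> that(1)] that below[of "(p, ds)"] by auto
  from val3_exact[OF assms(1,2) wf_rule(3)[OF assms(3)] this, of True]
  show "val3 (extend3 D3 \<Pi> (x, y)) v (body r) = TTrue \<longleftrightarrow> sat (extend D \<Pi> x) v (body r)"
    and "val3 (extend3 D3 \<Pi> (x, y)) v (body r) \<noteq> TFalse \<longleftrightarrow> sat (extend D \<Pi> y) v (body r)"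
    by simp_all
qed

lemma Phi_exact:
  assumes "x \<subseteq> y"
    and below: "\<And>e'. fst e' \<in> \<Pi> \<Longrightarrow> lv e' < lv e \<Longrightarrow> e' \<in> x \<longleftrightarrow> e' \<in> y"
  shows "e \<in> fst (\<Phi> (x, y)) \<longleftrightarrow> e \<in> T x" "e \<in> snd (\<Phi> (x, y)) \<longleftrightarrow> e \<in> T y"
proof -
  have head: "fst e = head_pred r" if "ground_head D v r = e" for v r
    using that by (auto simp: ground_head_def)
  show "e \<in> fst (\<Phi> (x, y)) \<longleftrightarrow> e \<in> T x" "e \<in> snd (\<Phi> (x, y)) \<longleftrightarrow> e \<in> T y"
    unfolding Phi_iff T_iff using body_exact[OF assms(1)] below head by metis+
qed

lemma Phi_consistent: "\<Phi> J \<in> consistent_pairs (Pow U)"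
  unfolding Phi_op_def ground_atoms_D3 by (rule tv_Collect_consistent)

lemma Phi_mono:
  assumes "fst K \<subseteq> snd K" "prec_le J K"
  shows "prec_le (\<Phi> J) (\<Phi> K)"
proof -
  have "tv_prec (val3 (extend3 D3 \<Pi> J) v (body r)) (val3 (extend3 D3 \<Pi> K) v (body r))"
    if "v \<in> assignments D" "r \<in> P" for v r
    using val3_mono[OF assms(2,1) that(1) wf_rule(3)[OF that(2)]] .
  then show ?thesis
    unfolding prec_le_def subset_iff Phi_iff tv_prec_iff by blast
qed

text \<open>Negation destroys monotonicity of \<open>T\<close> in general. Here
  \<open>(x, y)\<close> is exact below \<open>e\<close>, so at \<open>e\<close> the two components
  of \<open>\<Phi> (x, y)\<close> are \<open>T x\<close> and \<open>T y\<close>, and consistency of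
  the pair gives the inclusion.\<close>

lemma T_mono_level:
  assumes "x \<subseteq> y" "\<And>e'. fst e' \<in> \<Pi> \<Longrightarrow> lv e' < lv e \<Longrightarrow> e' \<in> x \<longleftrightarrow> e' \<in> y" "e \<in> T x"
  shows "e \<in> T y"
proof -
  have "e \<in> fst (\<Phi> (x, y))"
    using Phi_exact(1)[OF assms(1,2)] assms(3) by simp
  then have "e \<in> snd (\<Phi> (x, y))"
    using Phi_consistent[of "(x, y)"] by (auto simp: consistent_pairs_def)
  then show ?thesis
    using Phi_exact(2)[OF assms(1,2)] by simp
qed

lemma T_local:
  assumes "\<And>e'. fst e' \<in> \<Pi> \<Longrightarrow> lv e' \<le> lv e \<Longrightarrow> e' \<in> x \<longleftrightarrow> e' \<in> y"
  shows "e \<in> T x \<longleftrightarrow> e \<in> T y"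
proof -
  have "sat (extend D \<Pi> x) v (body r) = sat (extend D \<Pi> y) v (body r)"
    if "r \<in> P" "ground_head D v r = e" for v r
  proof (rule sat_pred_int_cong)
    fix p ds assume p: "p \<in> fm_preds (body r)"
    have "(p, ds) \<in> x \<longleftrightarrow> (p, ds) \<in> y" if "p \<in> \<Pi>"
      using assms[of "(p, ds)"] that lev_body(2)[OF \<open>r \<in> P\<close> that p]
        \<open>ground_head D v r = e\<close> by (auto simp: ground_head_def)
    then show "pred_int (extend D \<Pi> x) p ds = pred_int (extend D \<Pi> y) p ds"
      by simp
  qed simp_all
  then show ?thesis
    unfolding T_iff by blast
qed

section \<open>Strata and the standard model\<close>

abbreviation "S \<equiv> strata_model \<Pi> P D lev"
abbreviation "M \<equiv> standard_model \<Pi> P D lev"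

text \<open>The operator with index \<open>i\<close> belongs to level \<open>Suc i\<close>, levels
  being positive.\<close>

definition layer :: "nat \<Rightarrow> ('p \<times> 'd list) set \<Rightarrow> ('p \<times> 'd list) set" where
  "layer i = T_op {p \<in> \<Pi>. lev p = Suc i} {r \<in> P. lev (head_pred r) = Suc i}
     (extend D {p \<in> \<Pi>. lev p \<le> i} (S i))"

lemma strata_Suc: "S (Suc i) = S i \<union> lfp (layer i)"
  by (simp add: layer_def)

text \<open>The nested extension of \<open>D\<close> and the single one over \<open>\<Pi>\<close>
  can differ only on defined predicates above level \<open>Suc i\<close>, which do not occur in the
  rules of this layer. The bound on \<open>S i\<close> stays an assumption because its proof,
  \<open>strata_in_levels\<close>, passes through this lemma.\<close>

lemma layer_iff:
  assumes "\<And>e. e \<in> S i \<Longrightarrow> lv e \<le> i"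
  shows "e \<in> layer i X \<longleftrightarrow>
    lv e = Suc i \<and> e \<in> T (S i \<union> {e' \<in> X. fst e' \<in> \<Pi> \<and> lv e' = Suc i})"
proof -
  let ?E = "extend (extend D {p \<in> \<Pi>. lev p \<le> i} (S i)) {p \<in> \<Pi>. lev p = Suc i} X"
  let ?x = "S i \<union> {e' \<in> X. fst e' \<in> \<Pi> \<and> lv e' = Suc i}"
  have sat: "sat ?E v (body r) \<longleftrightarrow> sat (extend D \<Pi> ?x) v (body r)"
    if r: "r \<in> P" "lev (head_pred r) = Suc i" for v r
  proof (rule sat_pred_int_cong)
    fix p ds assume "p \<in> fm_preds (body r)"
    then have "lev p \<le> Suc i" if "p \<in> \<Pi>"
      using lev_body(2)[OF r(1) that] r(2) by simp
    moreover have "(p, ds) \<notin> S i" if "lev p = Suc i"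
      using assms[of "(p, ds)"] that by auto
    ultimately show "pred_int ?E p ds = pred_int (extend D \<Pi> ?x) p ds"
      by (auto simp: le_Suc_eq)
  qed simp_all
  have "e \<in> layer i X \<longleftrightarrow> (\<exists>v r. v \<in> assignments D \<and> r \<in> P \<and> ground_head D v r = e \<and>
      lev (head_pred r) = Suc i \<and> sat ?E v (body r))"
    by (auto simp: layer_def T_op_def)
  also have "\<dots> \<longleftrightarrow> (\<exists>v r. v \<in> assignments D \<and> r \<in> P \<and> ground_head D v r = e \<and>
      lv e = Suc i \<and> sat (extend D \<Pi> ?x) v (body r))"
    by (intro ex_cong1 conj_cong refl) (auto simp: ground_head_def sat)
  finally show ?thesis
    unfolding T_iff by blast
qed

lemma strata_in_levels: "e \<in> S i \<Longrightarrow> e \<in> U \<and> lv e \<le> i"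
proof (induction i arbitrary: e)
  case (Suc i)
  have "layer i X \<subseteq> {e \<in> U. lv e = Suc i}" for X
    using layer_iff[of i] Suc.IH T_sub by blast
  \<comment> \<open>A set containing all values of \<open>layer i\<close> is a prefixpoint, so this
    bound is available before monotonicity.\<close>
  then have "lfp (layer i) \<subseteq> {e \<in> U. lv e = Suc i}"
    by (rule lfp_lowerbound)
  then show ?case
    using Suc by (fastforce simp: strata_Suc simp del: strata_model.simps)
qed simp

lemmas layer_iff' = layer_iff[OF conjunct2[OF strata_in_levels]]

lemma layer_mono: "mono (layer i)"
proof (rule monoI, rule subsetI)
  fix X Y e assume "X \<subseteq> Y" and e: "e \<in> layer i X"
  have "e \<in> T (S i \<union> {e' \<in> Y. fst e' \<in> \<Pi> \<and> lv e' = Suc i})"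
    by (rule T_mono_level[of "S i \<union> {e' \<in> X. fst e' \<in> \<Pi> \<and> lv e' = Suc i}"])
      (use e \<open>X \<subseteq> Y\<close> in \<open>auto simp: layer_iff'\<close>)
  then show "e \<in> layer i Y"
    using e by (simp add: layer_iff')
qed

lemma lfp_layer_levels: "e \<in> lfp (layer i) \<Longrightarrow> lv e = Suc i"
  using lfp_fixpoint[OF layer_mono, of i] layer_iff' by blast

lemma strata_restrict: "i \<le> j \<Longrightarrow> lv e \<le> i \<Longrightarrow> e \<in> S j \<longleftrightarrow> e \<in> S i"
proof (induction j rule: dec_induct)
  case (step j)
  then show ?case
    using lfp_layer_levels[of e j] by (auto simp: strata_Suc simp del: strata_model.simps)
qed simp

lemma standard_model_restrict:
  assumes "lv e \<le> i"
  shows "e \<in> M \<longleftrightarrow> e \<in> S i"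
proof -
  have "e \<in> S j \<Longrightarrow> e \<in> S i" for j
    using strata_restrict[of i j e] strata_restrict[of j i e] strata_in_levels[of e j] assms
    by (cases "i \<le> j") auto
  then show ?thesis
    by (auto simp: standard_model_def)
qed

lemma standard_model_sub: "M \<subseteq> U"
  using strata_in_levels by (auto simp: standard_model_def)

lemma standard_model_layer: "lv e = Suc i \<Longrightarrow> e \<in> M \<longleftrightarrow> e \<in> lfp (layer i)"
  using standard_model_restrict[of e "Suc i"] strata_in_levels[of e i]
  by (auto simp: strata_Suc simp del: strata_model.simps)

text \<open>This transfers facts about a stratum to the global operator. \<open>X\<close> and
  \<open>x\<close> have to share only level \<open>Suc i\<close>: the fixpoint property takes
  \<open>X = lfp (layer i)\<close> and \<open>x = M\<close>, minimality takes
  \<open>X = x\<close>.\<close>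

lemma layer_eq_T:
  assumes "x \<subseteq> U" "lv e = Suc i" "\<And>e'. e' \<in> U \<Longrightarrow> lv e' < Suc i \<Longrightarrow> e' \<in> x \<longleftrightarrow> e' \<in> M"
    and "\<And>e'. lv e' = Suc i \<Longrightarrow> e' \<in> X \<longleftrightarrow> e' \<in> x"
  shows "e \<in> layer i X \<longleftrightarrow> e \<in> T x"
proof -
  have "e \<in> T (S i \<union> {e' \<in> X. fst e' \<in> \<Pi> \<and> lv e' = Suc i}) \<longleftrightarrow> e \<in> T x"
  proof (rule T_local)
    fix e' :: "'p \<times> 'd list" assume "fst e' \<in> \<Pi>" "lv e' \<le> lv e"
    then consider "lv e' \<le> i" | "lv e' = Suc i"
      using assms(2) by linarith
    then show "e' \<in> S i \<union> {e' \<in> X. fst e' \<in> \<Pi> \<and> lv e' = Suc i} \<longleftrightarrow> e' \<in> x"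
    proof cases
      case 1
      then show ?thesis
        using standard_model_restrict[OF 1] assms(1) assms(3)[of e'] standard_model_sub by auto
    next
      case 2
      then show ?thesis
        using strata_in_levels[of e' i] assms(4)[OF 2] \<open>fst e' \<in> \<Pi>\<close> by auto
    qed
  qed
  then show ?thesis
    using assms(2) by (simp add: layer_iff')
qed

lemma standard_model_fixpoint:
  assumes "e \<in> U"
  shows "e \<in> T M \<longleftrightarrow> e \<in> M"
proof -
  obtain i where i: "lv e = Suc i"
    using lev_pos[OF assms] gr0_implies_Suc by blast
  have "e \<in> layer i (lfp (layer i)) \<longleftrightarrow> e \<in> T M"
    by (rule layer_eq_T) (use standard_model_sub i standard_model_layer in auto)
  then show ?thesis
    using lfp_fixpoint[OF layer_mono, of i] standard_model_layer[OF i] by simp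
qed

lemma standard_model_least:
  assumes x: "x \<subseteq> U" "\<And>e'. e' \<in> U \<Longrightarrow> lv e' < n \<Longrightarrow> e' \<in> x \<longleftrightarrow> e' \<in> M"
    and pre: "\<And>e'. e' \<in> U \<Longrightarrow> lv e' = n \<Longrightarrow> e' \<in> T x \<Longrightarrow> e' \<in> x"
    and e: "e \<in> M" "lv e = n"
  shows "e \<in> x"
proof -
  obtain i where i: "n = Suc i"
    using lev_pos[of e] e standard_model_sub gr0_implies_Suc by blast
  \<comment> \<open>The whole of \<open>x\<close>, not merely its part on level \<open>n\<close>, is
    a prefixpoint, as \<open>layer i\<close> produces only atoms of that level.\<close>
  have "layer i x \<subseteq> x"
  proof
    fix e' assume e': "e' \<in> layer i x"
    then have lv: "lv e' = n"
      using i by (simp add: layer_iff')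
    then have "e' \<in> T x"
      using e' layer_eq_T[of x e' i x] x i by simp
    then show "e' \<in> x"
      using pre lv T_sub by blast
  qed
  then have "lfp (layer i) \<subseteq> x"
    by (rule lfp_lowerbound)
  then show ?thesis
    using e i standard_model_layer by auto
qed

text \<open>The locale compares \<open>x\<close> and \<open>y\<close> on \<open>U\<close>, the
  preceding lemmas on all atoms of defined predicates. For subsets of \<open>U\<close> this is the
  same, as both omit everything else.\<close>

sublocale stratified_approximation U \<Phi> T lv M
proof
  fix x y and e :: "'p \<times> 'd list"
  assume "(x, y) \<in> consistent_pairs (Pow U)"
    and "\<And>e'. e' \<in> U \<Longrightarrow> lv e' < lv e \<Longrightarrow> e' \<in> x \<longleftrightarrow> e' \<in> y"
  then show "(e \<in> fst (\<Phi> (x, y)) \<longleftrightarrow> e \<in> T x) \<and> (e \<in> snd (\<Phi> (x, y)) \<longleftrightarrow> e \<in> T y)"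
    by (intro conjI Phi_exact) (auto simp: consistent_pairs_def)
next
  fix x y and e :: "'p \<times> 'd list"
  assume "x \<subseteq> U" "y \<subseteq> U" "\<And>e'. e' \<in> U \<Longrightarrow> lv e' \<le> lv e \<Longrightarrow> e' \<in> x \<longleftrightarrow> e' \<in> y"
  then show "e \<in> T x \<longleftrightarrow> e \<in> T y"
    by (intro T_local) auto
next
  fix p q :: "('p \<times> 'd list) set \<times> ('p \<times> 'd list) set"
  assume "q \<in> consistent_pairs (Pow U)" "prec_le p q"
  then show "prec_le (\<Phi> p) (\<Phi> q)"
    by (intro Phi_mono) (auto simp: consistent_pairs_def)
qed (use Phi_consistent standard_model_sub standard_model_fixpoint standard_model_least in blast)+

end

text \<open>The equivalences state existence and uniqueness together, and two-valuedness is the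
  equality of the two components of \<open>W\<close>.\<close>

theorem theorem6:
  fixes \<Sigma> :: "('s, 'f, 'p, 'a) signature"
    and \<Pi> :: "'p set"
    and P :: "('s, 'f, 'p, 'a) rule set"
    and D :: "('s, 'f, 'p, 'a, 'd) struct"
    and D3 :: "('s, 'f, 'p, 'a, 'd) struct3"
    and lev :: "'p \<Rightarrow> nat"
  assumes "is_algebra \<Sigma> D"
    and "aggregate_program \<Sigma> \<Pi> P"
    and "stratification \<Pi> P lev"
    and "approximates \<Sigma> \<Pi> D3 D"
  shows "(\<forall>W. well_founded_model \<Sigma> \<Pi> P D3 W \<longleftrightarrow>
              W = (standard_model \<Pi> P D lev, standard_model \<Pi> P D lev)) \<and>
         (\<forall>I. stable_model \<Sigma> \<Pi> P D3 I \<longleftrightarrow> I = standard_model \<Pi> P D lev)"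
proof -
  interpret stratified_program \<Sigma> \<Pi> D D3 P lev
    by unfold_locales (fact assms)+
  show ?thesis
    by (simp add: well_founded_model_def stable_model_def ground_atoms_D3
        well_founded_fixpoint_iff stable_fixpoint_iff)
qed

end
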